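(* (Julia's Lemma) Let $(X,d)$ be a proper geodesic Gromov hyperbolic metric space such that $\overline{X}^H$ is topologically equivalent to $\overline{X}^G$. Let $f\colon X\to X$ be a non-expanding self-map. Let $p\in X$ and $\eta\in\partial_GX$ be such that $\lambda_{\eta,p}<+\infty$. Let $\xi\in\partial_GX$ be the geodesic limit of $f$ at $\eta$. Then, for all $R>0$, $$f(E_p(\eta,R))\subseteq E_p(\xi,\lambda_{\eta,p}R).$$
   Context: $f$ is non-expanding if $d(f(x),f(y))\le d(x,y)$ for all $x,y$. A geodesic ray is an isometric map $\gamma\colon[0,+\infty)\to X$; two rays are asymptotic if $t\mapsto d(\gamma(t),\sigma(t))$ is bounded. Gromov compactification: $\partial_GX$ is the set of asymptoticity classes $[\gamma]$ of geodesic rays, and $\overline{X}^G=X\sqcup\partial_GX$ with its usual compact metrizable topology. Fixing $p\in X$, a sequence $(x_n)$ in $\overline{X}^G$ converges to $\xi\in\partial_GX$ iff, choosing geodesic segments $\gamma_n$ from $p$ to $x_n$ (if $x_n\in X$) or rays from $p$ representing $x_n$ (if $x_n\in\partial_GX$), every locally uniformly convergent subsequence of $(\gamma_n)$ has limit in the class $\xi$. Horofunction compactification: let $C(X)$ be the continuous real functions on $X$ with uniform convergence on compact subsets, and $C_*(X)$ its quotient by constants. $\overline{X}^H$ is the closure in $C_*(X)$ of the image of the embedding $i_H\colon x\mapsto[d(\,\cdot\,,x)]$, and $\partial_HX=\overline{X}^H\setminus i_H(X)$. For $a\in\partial_HX$ and $p\in X$, $h_{a,p}\in C(X)$ is the unique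 function with $[h_{a,p}]=a$ and $h_{a,p}(p)=0$, and the horosphere is $E_p(a,R)=\{h_{a,p}<\log R\}\subseteq X$. $\overline{X}^H$ and $\overline{X}^G$ are topologically equivalent if there is a homeomorphism between them commuting with the embeddings of $X$; in that case $\partial_HX$ and $\partial_GX$ are identified via it, so $E_p(\eta,R)$ makes sense for $\eta\in\partial_GX$. Dilation: $\lambda_{\eta,p}\in(0,+\infty]$ is defined by $\log\lambda_{\eta,p}=\liminf_{z\to\eta}\big(d(z,p)-d(f(z),p)\big)$, where $z\in X$, $z\to\eta$ in $\overline{X}^G$. Geodesic region: for a ray $\gamma$ and $R>0$, $A(\gamma,R)=\{x\in X: d(x,\gamma)<R\}$, with vertex $[\gamma]$. $f$ has geodesic limit $\xi$ at $\eta\in\partial_GX$ if for every sequence $(x_n)$ in $X$ converging to $\eta$ and contained in a geodesic region with vertex $\eta$, $f(x_n)\to\xi$ in $\overline{X}^G$. If $\lambda_{\eta,p}<+\infty$, then $f$ has a geodesic limit in $\partial_GX$ at $\eta$. *)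

theory Defs
  imports "HOL-Analysis.Analysis"
begin

section \<open>Geodesics and hyperbolicity\<close>

text \<open>The metric space is the whole of a type \<open>'a :: metric_space\<close>. Curves are functions on all
  of \<open>real\<close> of which only the values on the stated domain matter.\<close>

definition geodesic_segment :: "(real \<Rightarrow> 'a::metric_space) \<Rightarrow> 'a \<Rightarrow> 'a \<Rightarrow> bool" where
  "geodesic_segment c x y \<longleftrightarrow> c 0 = x \<and> c (dist x y) = y \<and>
     (\<forall>s\<in>{0..dist x y}. \<forall>t\<in>{0..dist x y}. dist (c s) (c t) = \<bar>s - t\<bar>)"

definition geodesic_ray :: "(real \<Rightarrow> 'a::metric_space) \<Rightarrow> bool" where
  "geodesic_ray c \<longleftrightarrow> (\<forall>s\<ge>0. \<forall>t\<ge>0. dist (c s) (c t) = \<bar>s - t\<bar>)"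

definition proper_space :: "'a::metric_space itself \<Rightarrow> bool" where
  "proper_space _ \<longleftrightarrow> (\<forall>(x::'a) r. compact (cball x r))"

definition geodesic_space :: "'a::metric_space itself \<Rightarrow> bool" where
  "geodesic_space _ \<longleftrightarrow> (\<forall>(x::'a) y. \<exists>c. geodesic_segment c x y)"

text \<open>Geodesic triangles are uniformly thin. The condition is imposed on one side only; the
  vertices are labelled cyclically, so relabelling them gives it for the other two.\<close>

definition gromov_hyperbolic :: "'a::metric_space itself \<Rightarrow> bool" where
  "gromov_hyperbolic _ \<longleftrightarrow> (\<exists>\<delta>. \<forall>(x::'a) y z a b c.
     geodesic_segment a x y \<longrightarrow> geodesic_segment b y z \<longrightarrow> geodesic_segment c z x \<longrightarrow>
     (\<forall>u \<in> a ` {0..dist x y}. \<exists>v \<in> b ` {0..dist y z} \<union> c ` {0..dist z x}. dist u v \<le> \<delta>))"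

definition non_expanding :: "('a::metric_space \<Rightarrow> 'a) \<Rightarrow> bool" where
  "non_expanding f \<longleftrightarrow> (\<forall>x y. dist (f x) (f y) \<le> dist x y)"


section \<open>The Gromov compactification\<close>

definition asymptotic_rel :: "((real \<Rightarrow> 'a::metric_space) \<times> (real \<Rightarrow> 'a)) set" where
  "asymptotic_rel = {(c, d). geodesic_ray c \<and> geodesic_ray d \<and>
     bounded ((\<lambda>t. dist (c t) (d t)) ` {0..})}"

definition gromov_boundary :: "(real \<Rightarrow> 'a::metric_space) set set" where
  "gromov_boundary = {c. geodesic_ray c} // asymptotic_rel"

definition gromov_space :: "('a::metric_space + (real \<Rightarrow> 'a) set) set" where
  "gromov_space = range Inl \<union> Inr ` gromov_boundary"

text \<open>A geodesic from \<open>p\<close> to a point of the compactification. Segments are extended by a constant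
  to all of \<open>[0, \<infinity>)\<close>, so that locally uniform convergence makes sense for all these curves.\<close>

fun joins :: "'a::metric_space \<Rightarrow> 'a + (real \<Rightarrow> 'a) set \<Rightarrow> (real \<Rightarrow> 'a) \<Rightarrow> bool" where
  "joins p (Inl x) c \<longleftrightarrow> geodesic_segment c p x \<and> (\<forall>t \<ge> dist p x. c t = x)"
| "joins p (Inr \<zeta>) c \<longleftrightarrow> geodesic_ray c \<and> c 0 = p \<and> c \<in> \<zeta>"

definition loc_unif_conv :: "(nat \<Rightarrow> real \<Rightarrow> 'a::metric_space) \<Rightarrow> (real \<Rightarrow> 'a) \<Rightarrow> bool" where
  "loc_unif_conv c g \<longleftrightarrow> (\<forall>T. uniform_limit {0..T} c g sequentially)"

fun gromov_conv :: "'a::metric_space \<Rightarrow> (nat \<Rightarrow> 'a + (real \<Rightarrow> 'a) set) \<Rightarrow>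
    'a + (real \<Rightarrow> 'a) set \<Rightarrow> bool" where
  "gromov_conv p X (Inl x) \<longleftrightarrow>
     (\<exists>y. (\<forall>\<^sub>F n in sequentially. X n = Inl (y n)) \<and> y \<longlonglongrightarrow> x)"
| "gromov_conv p X (Inr \<xi>) \<longleftrightarrow>
     (\<exists>c. (\<forall>n. joins p (X n) (c n)) \<and>
       (\<forall>r g. strict_mono r \<longrightarrow> loc_unif_conv (c \<circ> r) g \<longrightarrow> g \<in> \<xi>))"

text \<open>The topology determined by sequential convergence: the open sets are the sequentially open
  ones. For a proper geodesic hyperbolic space this is the usual compact metrizable topology, and
  it does not depend on the base point \<open>p\<close>.\<close>

definition gromov_top :: "'a::metric_space \<Rightarrow> ('a + (real \<Rightarrow> 'a) set) topology" where
  "gromov_top p = topology (\<lambda>U. U \<subseteq> gromov_space \<and>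
     (\<forall>X l. (\<forall>n. X n \<in> gromov_space) \<longrightarrow> l \<in> U \<longrightarrow> gromov_conv p X l \<longrightarrow>
        (\<forall>\<^sub>F n in sequentially. X n \<in> U)))"

lemma openin_gromov_top:
  "openin (gromov_top p) U \<longleftrightarrow> U \<subseteq> gromov_space \<and>
     (\<forall>X l. (\<forall>n. X n \<in> gromov_space) \<longrightarrow> l \<in> U \<longrightarrow> gromov_conv p X l \<longrightarrow>
        (\<forall>\<^sub>F n in sequentially. X n \<in> U))"
proof -
  have "istopology (\<lambda>U. U \<subseteq> gromov_space \<and>
     (\<forall>X l. (\<forall>n. X n \<in> gromov_space) \<longrightarrow> l \<in> U \<longrightarrow> gromov_conv p X l \<longrightarrow>
        (\<forall>\<^sub>F n in sequentially. X n \<in> U)))" (is "istopology ?P")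
    unfolding istopology_def
  proof (intro conjI allI impI)
    fix S T assume S: "?P S" and T: "?P T"
    show "S \<inter> T \<subseteq> gromov_space" using S by blast
    fix X l assume X: "\<forall>n. X n \<in> gromov_space" "l \<in> S \<inter> T" "gromov_conv p X l"
    have "\<forall>\<^sub>F n in sequentially. X n \<in> S" "\<forall>\<^sub>F n in sequentially. X n \<in> T"
      using S T X by blast+
    then show "\<forall>\<^sub>F n in sequentially. X n \<in> S \<inter> T" by (simp add: eventually_conj)
  next
    fix K assume K: "\<forall>S\<in>K. ?P S"
    show "\<Union>K \<subseteq> gromov_space" using K by blast
    fix X l assume X: "\<forall>n. X n \<in> gromov_space" "l \<in> \<Union>K" "gromov_conv p X l"
    then obtain S where "S \<in> K" "l \<in> S" by blast
    with K X have "\<forall>\<^sub>F n in sequentially. X n \<in> S" by blast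
    then show "\<forall>\<^sub>F n in sequentially. X n \<in> \<Union>K"
      using \<open>S \<in> K\<close> by (auto elim: eventually_mono)
  qed
  then show ?thesis by (simp add: gromov_top_def topology_inverse')
qed

lemma topspace_gromov_top: "topspace (gromov_top p) = gromov_space"
proof -
  have "openin (gromov_top p) gromov_space" by (simp add: openin_gromov_top)
  then show ?thesis
    by (metis openin_gromov_top openin_subset openin_topspace subset_antisym)
qed


section \<open>The horofunction compactification\<close>

definition cont_funs :: "('a::metric_space \<Rightarrow> real) set" where
  "cont_funs = {h. continuous_on UNIV h}"

definition compact_conv_top :: "('a::metric_space \<Rightarrow> real) topology" where
  "compact_conv_top = topology (\<lambda>U. U \<subseteq> cont_funs \<and>
     (\<forall>g\<in>U. \<exists>K e. compact K \<and> e > 0 \<and> {h \<in> cont_funs. \<forall>x\<in>K. \<bar>h x - g x\<bar> < e} \<subseteq> U))"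

lemma openin_compact_conv_top:
  "openin compact_conv_top U \<longleftrightarrow> U \<subseteq> cont_funs \<and>
     (\<forall>g\<in>U. \<exists>K e. compact K \<and> e > 0 \<and> {h \<in> cont_funs. \<forall>x\<in>K. \<bar>h x - g x\<bar> < e} \<subseteq> U)"
proof -
  have "istopology (\<lambda>U::('a \<Rightarrow> real) set. U \<subseteq> cont_funs \<and>
     (\<forall>g\<in>U. \<exists>K e. compact K \<and> e > 0 \<and> {h \<in> cont_funs. \<forall>x\<in>K. \<bar>h x - g x\<bar> < e} \<subseteq> U))"
    (is "istopology ?P")
    unfolding istopology_def
  proof (intro conjI allI impI ballI)
    fix S T :: "('a \<Rightarrow> real) set" assume S: "?P S" and T: "?P T"
    show "S \<inter> T \<subseteq> cont_funs" using S by blast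
    fix g assume g: "g \<in> S \<inter> T"
    obtain K d where K: "compact K" "d > 0" "{h \<in> cont_funs. \<forall>x\<in>K. \<bar>h x - g x\<bar> < d} \<subseteq> S"
      using S g by blast
    obtain L e where L: "compact L" "e > 0" "{h \<in> cont_funs. \<forall>x\<in>L. \<bar>h x - g x\<bar> < e} \<subseteq> T"
      using T g by blast
    have "{h \<in> cont_funs. \<forall>x\<in>K \<union> L. \<bar>h x - g x\<bar> < min d e} \<subseteq> S \<inter> T"
      using K(3) L(3) by auto
    then show "\<exists>K e. compact K \<and> e > 0 \<and>
        {h \<in> cont_funs. \<forall>x\<in>K. \<bar>h x - g x\<bar> < e} \<subseteq> S \<inter> T"
      using K L by (intro exI[of _ "K \<union> L"] exI[of _ "min d e"]) auto
  next
    fix \<K> :: "('a \<Rightarrow> real) set set" assume K: "\<forall>S\<in>\<K>. ?P S"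
    show "\<Union>\<K> \<subseteq> cont_funs" using K by blast
    fix g assume "g \<in> \<Union>\<K>"
    then obtain S where "S \<in> \<K>" "g \<in> S" by blast
    have "?P S" using K \<open>S \<in> \<K>\<close> by (rule bspec)
    then obtain L e where "compact L" "e > 0"
      "{h \<in> cont_funs. \<forall>x\<in>L. \<bar>h x - g x\<bar> < e} \<subseteq> S" using \<open>g \<in> S\<close> by blast
    moreover from this(3) \<open>S \<in> \<K>\<close>
    have "{h \<in> cont_funs. \<forall>x\<in>L. \<bar>h x - g x\<bar> < e} \<subseteq> \<Union>\<K>"
      by (meson Union_upper subset_trans)
    ultimately show "\<exists>K e. compact K \<and> e > 0 \<and>
        {h \<in> cont_funs. \<forall>x\<in>K. \<bar>h x - g x\<bar> < e} \<subseteq> \<Union>\<K>"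
      by (intro exI[of _ L] exI[of _ e] conjI)
  qed
  then show ?thesis by (simp add: compact_conv_top_def topology_inverse')
qed

lemma topspace_compact_conv_top: "topspace compact_conv_top = cont_funs"
proof -
  have "openin compact_conv_top cont_funs"
    unfolding openin_compact_conv_top using compact_empty zero_less_one by blast
  then show ?thesis
    by (metis openin_compact_conv_top openin_subset openin_topspace subset_antisym)
qed

definition const_rel :: "(('a::metric_space \<Rightarrow> real) \<times> ('a \<Rightarrow> real)) set" where
  "const_rel = {(g, h). g \<in> cont_funs \<and> h \<in> cont_funs \<and> (\<exists>k. \<forall>x. h x = g x + k)}"

definition fun_class :: "('a::metric_space \<Rightarrow> real) \<Rightarrow> ('a \<Rightarrow> real) set" where
  "fun_class h = const_rel `` {h}"

definition quot_top :: "('a::metric_space \<Rightarrow> real) set topology" where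
  "quot_top = topology (\<lambda>U. U \<subseteq> cont_funs // const_rel \<and>
     openin compact_conv_top {h \<in> cont_funs. fun_class h \<in> U})"

lemma openin_quot_top:
  "openin quot_top U \<longleftrightarrow> U \<subseteq> cont_funs // const_rel \<and>
     openin compact_conv_top {h \<in> cont_funs. fun_class h \<in> U}"
proof -
  have "istopology (\<lambda>U::('a \<Rightarrow> real) set set. U \<subseteq> cont_funs // const_rel \<and>
     openin compact_conv_top {h \<in> cont_funs. fun_class h \<in> U})" (is "istopology ?P")
    unfolding istopology_def
  proof (intro conjI allI impI)
    fix S T :: "('a \<Rightarrow> real) set set" assume S: "?P S" and T: "?P T"
    show "S \<inter> T \<subseteq> cont_funs // const_rel" using S by blast
    have "{h \<in> cont_funs. fun_class h \<in> S \<inter> T} =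
        {h \<in> cont_funs. fun_class h \<in> S} \<inter> {h \<in> cont_funs. fun_class h \<in> T}" by blast
    then show "openin compact_conv_top {h \<in> cont_funs. fun_class h \<in> S \<inter> T}"
      using S T by auto
  next
    fix \<K> :: "('a \<Rightarrow> real) set set set" assume K: "\<forall>S\<in>\<K>. ?P S"
    show "\<Union>\<K> \<subseteq> cont_funs // const_rel" using K by blast
    have "{h \<in> cont_funs. fun_class h \<in> \<Union>\<K>} =
        (\<Union>S\<in>\<K>. {h \<in> cont_funs. fun_class h \<in> S})" by blast
    then show "openin compact_conv_top {h \<in> cont_funs. fun_class h \<in> \<Union>\<K>}"
      using K by auto
  qed
  then show ?thesis by (simp add: quot_top_def topology_inverse')
qed

lemma quotient_map_fun_class:
  "quotient_map compact_conv_top quot_top (fun_class :: ('a::metric_space \<Rightarrow> real) \<Rightarrow> _)"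
proof -
  let ?C = "cont_funs :: ('a \<Rightarrow> real) set"
  have img: "fun_class ` ?C = ?C // const_rel"
    by (auto simp: fun_class_def quotient_def)
  then have "{h \<in> ?C. fun_class h \<in> ?C // const_rel} = ?C"
    by blast
  moreover have "openin compact_conv_top ?C"
    using openin_topspace by (simp flip: topspace_compact_conv_top)
  ultimately have "openin quot_top (?C // const_rel)"
    unfolding openin_quot_top by simp
  moreover have "topspace quot_top \<subseteq> ?C // const_rel"
    using openin_topspace[of quot_top] unfolding openin_quot_top by (rule conjunct1)
  ultimately have "topspace quot_top = ?C // const_rel"
    by (simp add: openin_subset subset_antisym)
  then show ?thesis
    unfolding quotient_map_def topspace_compact_conv_top openin_quot_top using img by simp
qed

definition horo_embed :: "'a::metric_space \<Rightarrow> ('a \<Rightarrow> real) set" where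
  "horo_embed x = fun_class (\<lambda>y. dist y x)"

definition horo_top :: "('a::metric_space \<Rightarrow> real) set topology" where
  "horo_top = subtopology quot_top (quot_top closure_of range horo_embed)"

definition horo_boundary :: "('a::metric_space \<Rightarrow> real) set set" where
  "horo_boundary = topspace horo_top - range horo_embed"

definition horofunction :: "('a::metric_space \<Rightarrow> real) set \<Rightarrow> 'a \<Rightarrow> 'a \<Rightarrow> real" where
  "horofunction a p = (THE h. h \<in> a \<and> h p = 0)"

definition horosphere :: "'a::metric_space \<Rightarrow> ('a \<Rightarrow> real) set \<Rightarrow> real \<Rightarrow> 'a set" where
  "horosphere p a R = {x. horofunction a p x < ln R}"

text \<open>\<open>\<Phi>\<close> is a homeomorphism between the two compactifications commuting with the embeddings of
  the space. It is unique, by density; a point \<open>\<eta>\<close> of the Gromov boundary is identified with the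
  point \<open>\<Phi> (Inr \<eta>)\<close> of the horofunction boundary.\<close>

definition compactification_equiv ::
    "'a::metric_space \<Rightarrow> ('a + (real \<Rightarrow> 'a) set \<Rightarrow> ('a \<Rightarrow> real) set) \<Rightarrow> bool" where
  "compactification_equiv p \<Phi> \<longleftrightarrow>
     homeomorphic_map (gromov_top p) horo_top \<Phi> \<and> (\<forall>x. \<Phi> (Inl x) = horo_embed x)"


section \<open>Dilation and geodesic limits\<close>

text \<open>The exponential on \<open>[-\<infinity>, \<infinity>]\<close>, inverse to the extended logarithm.\<close>

definition exp_ereal :: "ereal \<Rightarrow> ereal" where
  "exp_ereal x = (case x of ereal r \<Rightarrow> ereal (exp r) | PInfty \<Rightarrow> \<infinity> | MInfty \<Rightarrow> 0)"

text \<open>The filter pulled back along \<open>Inl\<close> expresses \<open>z \<rightarrow> \<eta>\<close> with \<open>z\<close> ranging over the space only.\<close>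

definition dilation :: "('a::metric_space \<Rightarrow> 'a) \<Rightarrow> 'a \<Rightarrow> (real \<Rightarrow> 'a) set \<Rightarrow> ereal" where
  "dilation f p \<eta> = exp_ereal
     (Liminf (filtercomap Inl (nhdsin (gromov_top p) (Inr \<eta>)))
        (\<lambda>z. ereal (dist z p - dist (f z) p)))"

definition geodesic_region :: "(real \<Rightarrow> 'a::metric_space) \<Rightarrow> real \<Rightarrow> 'a set" where
  "geodesic_region c R = {x. infdist x (c ` {0..}) < R}"

definition has_geodesic_limit :: "'a::metric_space \<Rightarrow> ('a \<Rightarrow> 'a) \<Rightarrow>
    (real \<Rightarrow> 'a) set \<Rightarrow> 'a + (real \<Rightarrow> 'a) set \<Rightarrow> bool" where
  "has_geodesic_limit p f \<eta> l \<longleftrightarrow>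
     (\<forall>x c R. c \<in> \<eta> \<longrightarrow> R > 0 \<longrightarrow> (\<forall>n. x n \<in> geodesic_region c R) \<longrightarrow>
        limitin (gromov_top p) (\<lambda>n. Inl (x n)) (Inr \<eta>) sequentially \<longrightarrow>
        limitin (gromov_top p) (\<lambda>n. Inl (f (x n))) l sequentially)"

end

theory Submission
  imports Defs
begin

text \<open>If \<open>x\<^sub>n \<rightarrow> \<eta>\<close> and \<open>f x\<^sub>n \<rightarrow> \<xi>\<close>, then \<open>h\<^sub>\<eta>\<close> and \<open>h\<^sub>\<xi>\<close> are the pointwise limits of
  \<open>d(\<cdot>, x\<^sub>n) - d(p, x\<^sub>n)\<close> and \<open>d(\<cdot>, f x\<^sub>n) - d(p, f x\<^sub>n)\<close>. As \<open>f\<close> is non-expanding,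
  \<open>h\<^sub>\<xi>(f x) \<le> h\<^sub>\<eta>(x) + L\<close> follows whenever \<open>d(x\<^sub>n, p) - d(f x\<^sub>n, p) \<le> L\<close>, where \<open>L\<close> is the
  logarithm of the dilation. A sequence with this bound that also lies in a geodesic region is found
  on a ray from \<open>p\<close>: the limit of segments from \<open>p\<close> to points \<open>z\<^sub>n \<rightarrow> \<eta>\<close> almost attaining the
  liminf. This ray represents \<open>\<eta>\<close>: for a ray \<open>\<sigma>\<close> from \<open>p\<close> in \<open>\<eta>\<close> one has
  \<open>h\<^sub>\<eta>(\<sigma>(t)) = -t\<close>, so that \<open>d(\<sigma>(t), z) \<le> d(p, z) - t + 1\<close> for \<open>z\<close> near \<open>\<eta>\<close>, and by
  hyperbolicity \<open>\<sigma>\<close> and the segment from \<open>p\<close> to \<open>z\<close> stay close up to nearly time \<open>t\<close>.\<close>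

section \<open>Rays, segments and asymptotic classes\<close>

lemma gromov_boundaryD:
  assumes "\<eta> \<in> gromov_boundary"
  obtains c where "c \<in> \<eta>" "geodesic_ray c"
proof -
  obtain c where c: "geodesic_ray c" "\<eta> = asymptotic_rel `` {c}"
    using assms by (auto simp: gromov_boundary_def quotient_def)
  moreover have "(c, c) \<in> asymptotic_rel"
    using c(1) by (auto simp: asymptotic_rel_def bounded_iff)
  ultimately show thesis using that by blast
qed

text \<open>A class is generated by one ray \<open>c0\<close>; a bound against an arbitrary member
  \<open>c\<close> passes to \<open>c0\<close> by the triangle inequality. Limit rays are placed in
  their class this way.\<close>

lemma asymptotic_in_class:
  assumes "\<eta> \<in> gromov_boundary" "c \<in> \<eta>" "geodesic_ray g"
    and B: "\<And>t. t \<ge> 0 \<Longrightarrow> dist (c t) (g t) \<le> B"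
  shows "g \<in> \<eta>"
proof -
  obtain c0 where c0: "geodesic_ray c0" "\<eta> = asymptotic_rel `` {c0}"
    using assms(1) by (auto simp: gromov_boundary_def quotient_def)
  then have "bounded ((\<lambda>t. dist (c0 t) (c t)) ` {0..})"
    using assms(2) by (auto simp: asymptotic_rel_def)
  then obtain B0 where B0: "\<And>t. t \<ge> 0 \<Longrightarrow> dist (c0 t) (c t) \<le> B0"
    by (auto simp: bounded_iff)
  have "dist (c0 t) (g t) \<le> B0 + B" if "t \<ge> 0" for t
    using B0[OF that] B[OF that] dist_triangle[of "c0 t" "g t" "c t"] by linarith
  then have "bounded ((\<lambda>t. dist (c0 t) (g t)) ` {0..})"
    by (auto simp: bounded_iff)
  then show ?thesis using c0 assms(3) by (auto simp: asymptotic_rel_def)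
qed

lemma geodesic_ray_segment:
  assumes "geodesic_ray c" "T \<ge> 0"
  shows "geodesic_segment c (c 0) (c T)"
  using assms by (auto simp: geodesic_ray_def geodesic_segment_def)

lemma geodesic_segment_reverse:
  assumes "geodesic_segment c x y"
  shows "geodesic_segment (\<lambda>t. c (dist x y - t)) y x"
  using assms by (auto simp: geodesic_segment_def dist_commute[of y x])

lemma geodesic_segment_dist:
  assumes "geodesic_segment c x y" "0 \<le> t" "t \<le> dist x y"
  shows "dist x (c t) = t" "dist (c t) y = dist x y - t"
proof -
  have *: "\<forall>s\<in>{0..dist x y}. \<forall>t\<in>{0..dist x y}. dist (c s) (c t) = \<bar>s - t\<bar>"
    "c 0 = x" "c (dist x y) = y" using assms(1) by (auto simp: geodesic_segment_def)
  show "dist x (c t) = t"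
    using *(1)[rule_format, of 0 t] *(2) assms by simp
  show "dist (c t) y = dist x y - t"
    using *(1)[rule_format, of t "dist x y"] *(3) assms by simp
qed

section \<open>Continuity of normalized horofunctions\<close>

lemma horofunction_fun_class:
  fixes y p :: "'a::metric_space"
  assumes "h \<in> cont_funs"
  shows "horofunction (fun_class h) p y = h y - h p"
proof -
  have "(\<lambda>x. h x - h p) \<in> cont_funs"
    using assms by (auto simp: cont_funs_def intro!: continuous_intros)
  then have "(\<lambda>x. h x - h p) \<in> fun_class h"
    using assms by (auto simp: fun_class_def const_rel_def intro!: exI[of _ "- h p"])
  then have "horofunction (fun_class h) p = (\<lambda>x. h x - h p)"
    unfolding horofunction_def
  \<comment> \<open>Members of the class differ from \<open>h\<close> by a constant, which the value
    0 at \<open>p\<close> determines.\<close>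
  proof (intro the_equality)
    fix g assume "g \<in> fun_class h \<and> g p = 0"
    then show "g = (\<lambda>x. h x - h p)" by (auto simp: fun_class_def const_rel_def)
  qed simp
  then show ?thesis by simp
qed

text \<open>By the universal property of the quotient it suffices that
  \<open>h \<mapsto> h y - h p\<close> is continuous for compact convergence. This follows from
  control on the compact set \<open>{y, p}\<close>, with error \<open>e / 2\<close> at each
  point.\<close>

lemma continuous_map_horofunction:
  fixes y p :: "'a::metric_space"
  shows "continuous_map quot_top euclideanreal (\<lambda>a. horofunction a p y)"
proof (rule continuous_compose_quotient_map[OF quotient_map_fun_class])
  have "continuous_map compact_conv_top euclideanreal (\<lambda>h::'a \<Rightarrow> real. h y - h p)"
    unfolding continuous_map_def
  proof (intro conjI allI impI)
    fix U :: "real set" assume "openin euclideanreal U"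
    then have U: "open U" by simp
    show "openin compact_conv_top {h \<in> topspace compact_conv_top. h y - h p \<in> U}"
      unfolding openin_compact_conv_top topspace_compact_conv_top
    proof (intro conjI ballI)
      fix g assume "g \<in> {h \<in> cont_funs. h y - h p \<in> U}"
      then obtain e where e: "e > 0" "\<And>r. dist r (g y - g p) < e \<Longrightarrow> r \<in> U"
        using U unfolding open_dist by blast
      have "h y - h p \<in> U" if "\<bar>h y - g y\<bar> < e / 2" "\<bar>h p - g p\<bar> < e / 2" for h
        using that by (intro e(2)) (unfold dist_real_def, linarith)
      then show "\<exists>K e. compact K \<and> 0 < e \<and>
          {h \<in> cont_funs. \<forall>x\<in>K. \<bar>h x - g x\<bar> < e} \<subseteq> {h \<in> cont_funs. h y - h p \<in> U}"
        using e(1) by (intro exI[of _ "{y, p}"] exI[of _ "e / 2"]) auto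
    qed auto
  qed auto
  then show "continuous_map compact_conv_top euclideanreal
      ((\<lambda>a. horofunction a p y) \<circ> (fun_class :: ('a \<Rightarrow> real) \<Rightarrow> _))"
    by (rule continuous_map_eq)
      (simp add: topspace_compact_conv_top horofunction_fun_class)
qed

text \<open>\<open>\<Phi>\<close> followed by evaluation of the normalized horofunction is
  continuous and sends \<open>Inl z\<close> to \<open>dist y z - dist p z\<close>. The filter
  \<open>F\<close> is arbitrary to serve both sequences and the neighbourhood filter of a boundary
  point.\<close>

lemma tendsto_horofunction:
  fixes y p :: "'a::metric_space"
  assumes "compactification_equiv p \<Phi>"
    and "limitin (gromov_top p) (\<lambda>i. Inl (x i)) l F"
  shows "((\<lambda>i. dist y (x i) - dist p (x i)) \<longlongrightarrow> horofunction (\<Phi> l) p y) F"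
proof -
  have "continuous_map (gromov_top p) horo_top \<Phi>"
    using assms(1) by (simp add: compactification_equiv_def homeomorphic_imp_continuous_map)
  then have "continuous_map (gromov_top p) quot_top \<Phi>"
    unfolding horo_top_def by (simp add: continuous_map_in_subtopology)
  then have "continuous_map (gromov_top p) euclideanreal ((\<lambda>a. horofunction a p y) \<circ> \<Phi>)"
    using continuous_map_horofunction by (rule continuous_map_compose)
  from continuous_map_limit[OF this assms(2)]
  have "((\<lambda>i. horofunction (\<Phi> (Inl (x i))) p y) \<longlongrightarrow> horofunction (\<Phi> l) p y) F"
    by (simp add: o_def)
  moreover have "horofunction (\<Phi> (Inl z)) p y = dist y z - dist p z" for z
    using assms(1) horofunction_fun_class[of "\<lambda>y. dist y z" p y]
    by (simp add: compactification_equiv_def horo_embed_def cont_funs_def continuous_on_dist)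
  ultimately show ?thesis by simp
qed

section \<open>Convergence to boundary points\<close>

lemma gromov_conv_imp_limitin:
  assumes "gromov_conv p X l" "\<And>n. X n \<in> gromov_space" "l \<in> gromov_space"
  shows "limitin (gromov_top p) X l sequentially"
  unfolding limitin_def topspace_gromov_top
proof (intro conjI allI impI)
  fix U assume "openin (gromov_top p) U \<and> l \<in> U"
  then show "\<forall>\<^sub>F n in sequentially. X n \<in> U"
    unfolding openin_gromov_top using assms(1,2) by metis
qed fact

lemma limitin_gromov_ray:
  assumes "\<eta> \<in> gromov_boundary" "\<sigma> \<in> \<eta>" "geodesic_ray \<sigma>" "\<sigma> 0 = p"
  shows "limitin (gromov_top p) (\<lambda>n. Inl (\<sigma> (real n))) (Inr \<eta>) sequentially"
proof -
  \<comment> \<open>The ray stopped at time \<open>n\<close>, constant afterwards as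
    \<open>joins\<close> demands. At each fixed time these curves are eventually
    \<open>\<sigma> t\<close>, so every subsequential limit agrees with \<open>\<sigma>\<close> on
    \<open>[0, \<infinity>)\<close>.\<close>
  define c where "c n t = \<sigma> (min t (real n))" for n t
  have "g \<in> \<eta>" if r: "strict_mono r" and g: "loc_unif_conv (c \<circ> r) g" for r g
  proof -
    have "g t = \<sigma> t" if "t \<ge> 0" for t
    proof (rule LIMSEQ_unique)
      have "uniform_limit {0..t} (c \<circ> r) g sequentially"
        using g unfolding loc_unif_conv_def by blast
      then show "(\<lambda>n. (c \<circ> r) n t) \<longlonglongrightarrow> g t"
        using that by (auto dest: tendsto_uniform_limitI[where x = t])
      have "\<forall>\<^sub>F n in sequentially. (c \<circ> r) n t = \<sigma> t"
        using eventually_ge_at_top[of "nat \<lceil>t\<rceil>"]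
      proof eventually_elim
        case (elim n)
        then have "t \<le> real (r n)"
          using seq_suble[OF r, of n] by linarith
        then show ?case by (simp add: c_def)
      qed
      then show "(\<lambda>n. (c \<circ> r) n t) \<longlonglongrightarrow> \<sigma> t" by (rule tendsto_eventually)
    qed
    \<comment> \<open>\<open>g\<close> may differ from \<open>\<sigma>\<close> at negative times, so
      membership in the class comes from the distance bound 0.\<close>
    then show ?thesis
      using assms(3) by (intro asymptotic_in_class[OF assms(1,2), of g 0])
        (auto simp: geodesic_ray_def)
  qed
  moreover have "joins p (Inl (\<sigma> (real n))) (c n)" for n
    using assms(3,4) by (auto simp: geodesic_segment_def geodesic_ray_def c_def min_def)
  ultimately have "gromov_conv p (\<lambda>n. Inl (\<sigma> (real n))) (Inr \<eta>)"
    by auto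
  then show ?thesis
    by (rule gromov_conv_imp_limitin) (use assms(1) in \<open>auto simp: gromov_space_def\<close>)
qed

section \<open>Limits and fellow-travelling of geodesic segments\<close>

text \<open>Tychonoff's theorem for the product topology on curves replaces Arzela--Ascoli: pointwise
  convergence along some filter finer than \<open>sequentially\<close> is enough to pass closed conditions to
  the limit.\<close>

lemma geodesic_segments_cluster:
  fixes p :: "'a::metric_space"
  assumes proper: "proper_space TYPE('a)"
    and seg: "\<And>n. geodesic_segment (c n) p (z n)"
    and inf: "filterlim (\<lambda>n. dist p (z n)) at_top sequentially"
  obtains g G where "G \<noteq> bot" "G \<le> sequentially" "geodesic_ray g" "g 0 = p"
    "\<And>t. t \<ge> 0 \<Longrightarrow> ((\<lambda>n. c n t) \<longlongrightarrow> g t) G"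
proof -
  \<comment> \<open>Resetting values off the domain of the segment to \<open>p\<close> keeps
    \<open>c' n t\<close> in \<open>cball p |t|\<close> for every real \<open>t\<close>, so all
    curves lie in the compact product \<open>S\<close>.\<close>
  define c' where "c' n t = (if 0 \<le> t \<and> t \<le> dist p (z n) then c n t else p)" for n t
  define S where "S = (\<Pi>\<^sub>E t\<in>(UNIV::real set). cball p \<bar>t\<bar>)"
  have "compactin (product_topology (\<lambda>i. euclidean) UNIV) S"
    using proper by (simp add: S_def compactin_PiE proper_space_def)
  then have "compact S" by (simp add: euclidean_product_topology)
  moreover have "c' n \<in> S" for n
    using geodesic_segment_dist(1)[OF seg[of n]] by (auto simp: S_def c'_def)
  ultimately obtain g where g: "inf (nhds g) (filtermap c' sequentially) \<noteq> bot"
    unfolding compact_filter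
    by (metis (mono_tags, lifting) always_eventually eventually_filtermap filtermap_bot_iff
        sequentially_bot)
  \<comment> \<open>The neighbourhoods of the cluster point \<open>g\<close>, pulled back to
    indices; along \<open>G\<close> the curves converge to \<open>g\<close>. Were \<open>G\<close>
    trivial, some neighbourhood of \<open>g\<close> would miss a tail of the curves.\<close>
  define G where "G = inf (filtercomap c' (nhds g)) sequentially"
  have "G \<noteq> bot"
  proof
    assume "G = bot"
    then obtain P Q where PQ: "eventually P (filtercomap c' (nhds g))" "eventually Q sequentially"
      "\<And>n. P n \<Longrightarrow> Q n \<Longrightarrow> False"
      unfolding G_def trivial_limit_def eventually_inf by blast
    then obtain P' where P': "eventually P' (nhds g)" "\<And>n. P' (c' n) \<Longrightarrow> P n"
      by (auto simp: eventually_filtercomap)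
    have "eventually (\<lambda>h. \<not> P' h) (filtermap c' sequentially)"
      unfolding eventually_filtermap using PQ(2) by eventually_elim (use PQ P' in blast)
    with P'(1) g show False
      unfolding trivial_limit_def eventually_inf by blast
  qed
  have G: "G \<le> sequentially" by (simp add: G_def)
  have dom: "\<forall>\<^sub>F n in G. t \<le> dist p (z n)" for t
    using filterlim_mono[OF inf order_refl G] by (simp add: filterlim_at_top)
  have lim: "((\<lambda>n. c n t) \<longlongrightarrow> g t) G" if "t \<ge> 0" for t
  proof (rule Lim_transform_eventually)
    have "filterlim c' (nhds g) G"
      unfolding filterlim_iff_le_filtercomap by (simp add: G_def)
    then show "((\<lambda>n. c' n t) \<longlongrightarrow> g t) G"
      using continuous_on_tendsto_compose[OF continuous_on_product_coordinates[of t]] by simp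
    show "\<forall>\<^sub>F n in G. c' n t = c n t"
      using dom[of t] by eventually_elim (simp add: c'_def that)
  qed
  have "dist (g s) (g t) = \<bar>s - t\<bar>" if "s \<ge> 0" "t \<ge> 0" for s t
  proof (rule tendsto_unique[OF \<open>G \<noteq> bot\<close>])
    show "((\<lambda>n. dist (c n s) (c n t)) \<longlongrightarrow> dist (g s) (g t)) G"
      using that by (intro tendsto_dist lim)
    have "\<forall>\<^sub>F n in G. dist (c n s) (c n t) = \<bar>s - t\<bar>"
      using dom[of s] dom[of t]
      by eventually_elim (use seg that in \<open>auto simp: geodesic_segment_def\<close>)
    then show "((\<lambda>n. dist (c n s) (c n t)) \<longlongrightarrow> \<bar>s - t\<bar>) G" by (rule tendsto_eventually)
  qed
  then have "geodesic_ray g" by (simp add: geodesic_ray_def)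
  moreover have "c n 0 = p" for n using seg by (auto simp: geodesic_segment_def)
  then have "g 0 = p"
    using lim[of 0] \<open>G \<noteq> bot\<close> by (simp add: tendsto_const_iff)
  ultimately show thesis
    using that \<open>G \<noteq> bot\<close> G lim by blast
qed

text \<open>The condition in \<open>gromov_hyperbolic\<close> for a given constant, so that one
  \<delta> can be fixed throughout.\<close>

definition thin_triangles :: "'a::metric_space itself \<Rightarrow> real \<Rightarrow> bool" where
  "thin_triangles _ \<delta> \<longleftrightarrow> (\<forall>(x::'a) y z a b c.
     geodesic_segment a x y \<longrightarrow> geodesic_segment b y z \<longrightarrow> geodesic_segment c z x \<longrightarrow>
     (\<forall>u \<in> a ` {0..dist x y}. \<exists>v \<in> b ` {0..dist y z} \<union> c ` {0..dist z x}. dist u v \<le> \<delta>))"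

lemma thin_trianglesD:
  fixes x y z :: "'a::metric_space"
  assumes "thin_triangles TYPE('a) \<delta>"
    and "geodesic_segment a x y" "geodesic_segment b y z" "geodesic_segment c z x"
    and "u \<in> a ` {0..dist x y}"
  shows "\<exists>v \<in> b ` {0..dist y z} \<union> c ` {0..dist z x}. dist u v \<le> \<delta>"
  by (rule assms(1)[unfolded thin_triangles_def, rule_format, OF assms(2-5)])

text \<open>In the triangle \<open>p\<close>, \<open>x\<close>, \<open>z\<close>, a point
  \<open>a u\<close> well before \<open>x\<close> cannot be near the side from \<open>x\<close> to
  \<open>z\<close>: detours through that side would give
  \<open>2 * dist p x \<le> 2 * u + 2 * \<delta> + 1\<close>. So it is near some \<open>b w\<close>,
  where \<open>w\<close> and \<open>u\<close> are distances from \<open>p\<close> and differ by at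
  most \<delta>.\<close>

lemma geodesic_segments_fellow_travel:
  fixes p :: "'a::metric_space"
  assumes geo: "geodesic_space TYPE('a)"
    and thin: "thin_triangles TYPE('a) \<delta>"
    and a: "geodesic_segment a p x" and b: "geodesic_segment b p z"
    and near: "dist x z \<le> dist p z - dist p x + 1"
    and u: "0 \<le> u" "u + \<delta> + 1 \<le> dist p x"
  shows "dist (a u) (b u) \<le> 2 * \<delta>"
proof -
  obtain c where c: "geodesic_segment c x z" using geo by (auto simp: geodesic_space_def)
  have "\<delta> \<ge> 0"
  proof -
    have "geodesic_segment (\<lambda>t. p) p p" by (simp add: geodesic_segment_def)
    from thin_trianglesD[OF thin this this this, of p] show ?thesis
      by simp
  qed
  with u have ux: "u \<le> dist p x" by simp
  have upz: "u \<le> dist p z" using near u \<open>\<delta> \<ge> 0\<close> zero_le_dist[of x z] by linarith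
  note au = geodesic_segment_dist[OF a u(1) ux]
  obtain v where v: "v \<in> c ` {0..dist x z} \<union> (\<lambda>t. b (dist p z - t)) ` {0..dist z p}"
    "dist (a u) v \<le> \<delta>"
    using thin_trianglesD[OF thin a c geodesic_segment_reverse[OF b], of "a u"] u ux by auto
  have "v \<notin> c ` {0..dist x z}"
  proof
    assume "v \<in> c ` {0..dist x z}"
    then obtain w where w: "v = c w" "0 \<le> w" "w \<le> dist x z" by auto
    note vw = geodesic_segment_dist[OF c w(2,3)]
    have "dist p x \<le> dist p (a u) + dist (a u) v + dist v x"
      using dist_triangle[of p x v] dist_triangle[of p v "a u"] by linarith
    moreover have "dist p z \<le> dist p (a u) + dist (a u) v + dist v z"
      using dist_triangle[of p z v] dist_triangle[of p v "a u"] by linarith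
    ultimately show False
      using vw au v(2) near u w(1) by (simp add: dist_commute)
  qed
  with v(1) obtain w where w: "v = b w" "0 \<le> w" "w \<le> dist p z"
    by (auto simp: dist_commute)
  have "dist (b w) (b u) = \<bar>w - u\<bar>"
    using b w u upz by (auto simp: geodesic_segment_def)
  moreover have "\<bar>w - u\<bar> \<le> dist (a u) v"
    using geodesic_segment_dist(1)[OF b w(2,3)] au(1) w(1)
      dist_triangle[of p v "a u"] dist_triangle[of p "a u" v] by (simp add: dist_commute)
  ultimately show ?thesis
    using v(2) w(1) dist_triangle[of "a u" "b u" v] by simp
qed

text \<open>A representative \<open>\<tau>\<close> may start elsewhere. Segments from
  \<open>p\<close> to \<open>\<tau> (real n)\<close> cluster at a ray from \<open>p\<close>; the
  triangle \<open>p\<close>, \<open>\<tau> (real n)\<close>, \<open>\<tau> 0\<close> has one side of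
  fixed length \<open>D\<close>, so the segments stay uniformly near \<open>\<tau>\<close>.\<close>

lemma ray_from_base_point:
  fixes p :: "'a::metric_space"
  assumes proper: "proper_space TYPE('a)" and geo: "geodesic_space TYPE('a)"
    and thin: "thin_triangles TYPE('a) \<delta>"
    and \<eta>: "\<eta> \<in> gromov_boundary"
  obtains \<sigma> where "\<sigma> \<in> \<eta>" "geodesic_ray \<sigma>" "\<sigma> 0 = p"
proof -
  obtain \<tau> where \<tau>: "\<tau> \<in> \<eta>" "geodesic_ray \<tau>" using gromov_boundaryD[OF \<eta>] .
  define D where "D = dist p (\<tau> 0)"
  have \<tau>_dist: "dist (\<tau> s) (\<tau> t) = \<bar>s - t\<bar>" if "s \<ge> 0" "t \<ge> 0" for s t
    using \<tau>(2) that by (auto simp: geodesic_ray_def)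
  have "\<exists>c. \<forall>n. geodesic_segment (c n) p (\<tau> (real n))"
    using geo unfolding geodesic_space_def by (intro choice) auto
  then obtain c where c: "\<And>n. geodesic_segment (c n) p (\<tau> (real n))" by blast
  obtain b where b: "geodesic_segment b (\<tau> 0) p" using geo by (auto simp: geodesic_space_def)
  have inf: "filterlim (\<lambda>n. dist p (\<tau> (real n))) at_top sequentially"
  proof (rule filterlim_at_top_mono)
    show "filterlim (\<lambda>n. - D + real n) at_top sequentially"
      by (rule filterlim_tendsto_add_at_top[OF tendsto_const filterlim_real_sequentially])
    have "- D + real n \<le> dist p (\<tau> (real n))" for n
      using dist_triangle2[of "\<tau> 0" "\<tau> (real n)" p] \<tau>_dist[of 0 "real n"]
      by (simp add: D_def dist_commute)
    then show "\<forall>\<^sub>F n in sequentially. - D + real n \<le> dist p (\<tau> (real n))" by simp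
  qed
  \<comment> \<open>Some \<open>\<tau> w\<close> is within \<open>\<delta> + D\<close>, namely
    \<open>\<tau> 0\<close> if the near side is \<open>b\<close>. Comparing distances from
    \<open>p\<close> and \<open>\<tau> 0\<close>, \<open>w\<close> and \<open>t\<close> differ by at
    most \<open>\<delta> + 2 * D\<close>; the sum is the constant.\<close>
  have fellow: "dist (c n t) (\<tau> t) \<le> 2 * \<delta> + 3 * D"
    if t: "0 \<le> t" "t \<le> dist p (\<tau> (real n))" for n t
  proof -
    have dn: "dist (\<tau> 0) (\<tau> (real n)) = real n" using \<tau>_dist[of 0 "real n"] by simp
    obtain v where v: "v \<in> (\<lambda>s. \<tau> (real n - s)) ` {0..real n} \<union> b ` {0..D}"
      "dist (c n t) v \<le> \<delta>"
      using thin_trianglesD[OF thin c[of n] geodesic_segment_reverse[OF geodesic_ray_segment[OF \<tau>(2), of "real n"]] b,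
          of "c n t"] t dn
      by (auto simp: dist_commute D_def)
    have "\<exists>w\<ge>0. dist (c n t) (\<tau> w) \<le> \<delta> + D"
      using v(1)
    proof
      assume "v \<in> b ` {0..D}"
      then obtain s where "v = b s" "0 \<le> s" "s \<le> D" by auto
      then have "dist v (\<tau> 0) \<le> D"
        using geodesic_segment_dist(1)[OF b, of s] by (simp add: D_def dist_commute)
      then show ?thesis
        using v(2) dist_triangle[of "c n t" "\<tau> 0" v] by (intro exI[of _ 0]) auto
    next
      assume "v \<in> (\<lambda>s. \<tau> (real n - s)) ` {0..real n}"
      then obtain s where "v = \<tau> (real n - s)" "s \<le> real n" by auto
      then show ?thesis
        using v(2) zero_le_dist[of p "\<tau> 0"]
        by (intro exI[of _ "real n - s"]) (auto simp: D_def intro: order_trans)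
    qed
    then obtain w where w: "w \<ge> 0" "dist (c n t) (\<tau> w) \<le> \<delta> + D" by blast
    have "dist p (c n t) = t" using geodesic_segment_dist(1)[OF c t] .
    moreover have "dist (\<tau> 0) (\<tau> w) = w" using \<tau>_dist[of 0 w] w by simp
    ultimately have "\<bar>w - t\<bar> \<le> dist (c n t) (\<tau> w) + D"
      using dist_triangle[of p "c n t" "\<tau> w"] dist_triangle[of p "\<tau> w" "\<tau> 0"]
        dist_triangle[of "\<tau> 0" "\<tau> w" p] dist_triangle[of p "\<tau> w" "c n t"]
      by (simp add: D_def dist_commute)
    then show ?thesis
      using dist_triangle[of "c n t" "\<tau> t" "\<tau> w"] \<tau>_dist[of w t] w t by simp
  qed
  obtain \<sigma> G where G: "G \<noteq> bot" "G \<le> sequentially" and \<sigma>: "geodesic_ray \<sigma>" "\<sigma> 0 = p"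
    and lim: "\<And>t. t \<ge> 0 \<Longrightarrow> ((\<lambda>n. c n t) \<longlongrightarrow> \<sigma> t) G"
    using geodesic_segments_cluster[OF proper c inf] by blast
  have "dist (\<tau> t) (\<sigma> t) \<le> 2 * \<delta> + 3 * D" if "t \<ge> 0" for t
  proof (rule tendsto_upperbound[OF _ _ G(1)])
    show "((\<lambda>n. dist (\<tau> t) (c n t)) \<longlongrightarrow> dist (\<tau> t) (\<sigma> t)) G"
      using that by (intro tendsto_intros lim)
    have "\<forall>\<^sub>F n in G. t \<le> dist p (\<tau> (real n))"
      using filterlim_mono[OF inf order_refl G(2)] by (simp add: filterlim_at_top)
    then show "\<forall>\<^sub>F n in G. dist (\<tau> t) (c n t) \<le> 2 * \<delta> + 3 * D"
      by eventually_elim (use fellow that in \<open>auto simp: dist_commute\<close>)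
  qed
  then have "\<sigma> \<in> \<eta>" using asymptotic_in_class[OF \<eta> \<tau>(1) \<sigma>(1)] by blast
  with \<sigma> that show thesis by blast
qed

section \<open>Dilation and a ray realizing it\<close>

text \<open>The bracket is twice the Gromov product of \<open>p\<close> and \<open>w\<close> at
  \<open>z\<close>; it vanishes when \<open>z\<close> lies on a geodesic from \<open>p\<close> to
  \<open>w\<close>.\<close>

lemma non_expanding_displacement:
  assumes "non_expanding f"
  shows "dist z p - dist (f z) p \<le> dist w p - dist (f w) p + (dist z p + dist z w - dist w p)"
proof -
  have "dist (f w) (f z) \<le> dist z w"
    using assms unfolding non_expanding_def by (metis dist_commute)
  then show ?thesis using dist_triangle[of "f w" p "f z"] by linarith
qed

text \<open>The displacement is at least \<open>- dist (f p) p\<close>, so the \<open>Liminf\<close>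
  is not \<open>-\<infinity>\<close>, and finite dilation excludes \<open>\<infinity>\<close>;
  \<open>L\<close> is its real value. If the bound failed to hold frequently, the
  \<open>Liminf\<close> would be at least \<open>L + e\<close>.\<close>

lemma dilation_finite:
  fixes p :: "'a::metric_space"
  assumes "non_expanding f" "dilation f p \<eta> < \<infinity>"
  obtains L where "dilation f p \<eta> = ereal (exp L)"
    "\<And>e. e > 0 \<Longrightarrow> \<exists>\<^sub>F z in filtercomap Inl (nhdsin (gromov_top p) (Inr \<eta>)).
        dist z p - dist (f z) p < L + e"
proof -
  define F where "F = filtercomap (Inl :: 'a \<Rightarrow> _) (nhdsin (gromov_top p) (Inr \<eta>))"
  define \<phi> where "\<phi> z = dist z p - dist (f z) p" for z
  define L' where "L' = Liminf F (\<lambda>z. ereal (\<phi> z))"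
  have dil: "dilation f p \<eta> = exp_ereal L'"
    by (simp add: dilation_def L'_def F_def \<phi>_def)
  have "- dist (f p) p \<le> \<phi> z" for z
    using assms(1) dist_triangle[of "f z" p "f p"]
    unfolding non_expanding_def \<phi>_def by (smt (verit))
  then have "ereal (- dist (f p) p) \<le> L'"
    unfolding L'_def by (intro Liminf_bounded always_eventually) simp
  moreover have "L' \<noteq> \<infinity>" using assms(2) dil by (auto simp: exp_ereal_def)
  ultimately obtain L where L: "L' = ereal L" by (cases L') auto
  have "\<exists>\<^sub>F z in F. \<phi> z < L + e" if "e > 0" for e
  proof (rule ccontr)
    assume "\<not> (\<exists>\<^sub>F z in F. \<phi> z < L + e)"
    then have "\<forall>\<^sub>F z in F. ereal (L + e) \<le> ereal (\<phi> z)"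
      by (simp add: not_frequently not_less)
    then have "ereal (L + e) \<le> L'" unfolding L'_def by (rule Liminf_bounded)
    with L that show False by simp
  qed
  with that[of L] dil L show thesis
    by (simp add: exp_ereal_def F_def \<phi>_def)
qed

text \<open>Along a geodesic from \<open>p\<close> to \<open>z\<close> the quantity \<open>d(\<cdot>, p) - d(f \<cdot>, p)\<close> never
  exceeds its value at \<open>z\<close>; so this bound survives in the limit ray as \<open>z\<close> tends to \<open>\<eta>\<close>.\<close>

lemma ray_realizing_dilation:
  fixes p :: "'a::metric_space"
  assumes proper: "proper_space TYPE('a)" and geo: "geodesic_space TYPE('a)"
    and "gromov_hyperbolic TYPE('a)"
    and equiv: "compactification_equiv p \<Phi>"
    and f: "non_expanding f"
    and \<eta>: "\<eta> \<in> gromov_boundary"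
    and freq: "\<And>e. e > 0 \<Longrightarrow> \<exists>\<^sub>F z in filtercomap Inl (nhdsin (gromov_top p) (Inr \<eta>)).
        dist z p - dist (f z) p < L + e"
  obtains g where "g \<in> \<eta>" "geodesic_ray g" "g 0 = p"
    "\<And>t. t \<ge> 0 \<Longrightarrow> t - dist (f (g t)) p \<le> L"
proof -
  obtain \<delta> where thin: "thin_triangles TYPE('a) \<delta>"
    using assms(3) unfolding gromov_hyperbolic_def thin_triangles_def by blast
  obtain \<sigma> where \<sigma>: "\<sigma> \<in> \<eta>" "geodesic_ray \<sigma>" "\<sigma> 0 = p"
    using ray_from_base_point[OF proper geo thin \<eta>] by blast
  define F where "F = filtercomap (Inl :: 'a \<Rightarrow> _) (nhdsin (gromov_top p) (Inr \<eta>))"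
  have \<sigma>_dist: "dist (\<sigma> s) (\<sigma> t) = \<bar>s - t\<bar>" if "s \<ge> 0" "t \<ge> 0" for s t
    using \<sigma>(2) that by (auto simp: geodesic_ray_def)
  have p\<sigma>: "dist p (\<sigma> t) = t" if "t \<ge> 0" for t
    using \<sigma>_dist[of 0 t] \<sigma>(3) that by simp
  have horo_\<sigma>: "horofunction (\<Phi> (Inr \<eta>)) p (\<sigma> t) = - t" if t: "t \<ge> 0" for t
  proof (rule LIMSEQ_unique)
    show "(\<lambda>n. dist (\<sigma> t) (\<sigma> (real n)) - dist p (\<sigma> (real n)))
        \<longlonglongrightarrow> horofunction (\<Phi> (Inr \<eta>)) p (\<sigma> t)"
      by (rule tendsto_horofunction[OF equiv limitin_gromov_ray[OF \<eta> \<sigma>]])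
    have "\<forall>\<^sub>F n in sequentially. dist (\<sigma> t) (\<sigma> (real n)) - dist p (\<sigma> (real n)) = - t"
      using eventually_ge_at_top[of "nat \<lceil>t\<rceil>"]
    proof eventually_elim
      case (elim n)
      then have "t \<le> real n" by linarith
      then show ?case using \<sigma>_dist[of t "real n"] p\<sigma>[of "real n"] t by simp
    qed
    then show "(\<lambda>n. dist (\<sigma> t) (\<sigma> (real n)) - dist p (\<sigma> (real n))) \<longlonglongrightarrow> - t"
      by (rule tendsto_eventually)
  qed
  have limF: "limitin (gromov_top p) Inl (Inr \<eta>) F"
  proof -
    have "Inr \<eta> \<in> topspace (gromov_top p)"
      using \<eta> by (simp add: topspace_gromov_top gromov_space_def)
    moreover have "\<forall>\<^sub>F z in F. Inl z \<in> U" if "openin (gromov_top p) U" "Inr \<eta> \<in> U" for U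
    proof -
      have "eventually (\<lambda>y. y \<in> U) (nhdsin (gromov_top p) (Inr \<eta>))"
        unfolding eventually_nhdsin using that by (intro disjI2 exI[of _ U]) simp
      then show ?thesis unfolding F_def by (rule eventually_filtercomapI)
    qed
    ultimately show ?thesis unfolding limitin_def by simp
  qed
  \<comment> \<open>The first condition holds frequently near \<eta>, the second eventually, because
    the horofunction at \<open>\<sigma> (real n)\<close> is \<open>- real n\<close>; so some
    \<open>z\<close> satisfies both. The slack 1 is that of
    \<open>geodesic_segments_fellow_travel\<close>, and the second condition also forces
    \<open>dist p z \<ge> n - 1\<close>.\<close>
  have "\<exists>z. dist z p - dist (f z) p < L + inverse (real (Suc n)) \<and>
      dist (\<sigma> (real n)) z - dist p z < - real n + 1" for n
  proof -
    have "\<forall>\<^sub>F z in F. dist (\<sigma> (real n)) z - dist p z < - real n + 1"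
      using horo_\<sigma>[of "real n"]
      by (intro order_tendstoD(2)[OF tendsto_horofunction[OF equiv limF]]) simp
    moreover have "\<exists>\<^sub>F z in F. dist z p - dist (f z) p < L + inverse (real (Suc n))"
      using freq[of "inverse (real (Suc n))"] by (simp add: F_def)
    ultimately show ?thesis
      using frequently_ex[OF frequently_eventually_conj] by blast
  qed
  then obtain z where z: "\<And>n. dist (z n) p - dist (f (z n)) p < L + inverse (real (Suc n))"
      "\<And>n. dist (\<sigma> (real n)) (z n) - dist p (z n) < - real n + 1"
    by metis
  have zn: "real n - 1 \<le> dist p (z n)" for n
    using z(2)[of n] zero_le_dist[of "\<sigma> (real n)" "z n"] by linarith
  have inf: "filterlim (\<lambda>n. dist p (z n)) at_top sequentially"
  proof (rule filterlim_at_top_mono)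
    show "filterlim (\<lambda>n. - 1 + real n) at_top sequentially"
      by (rule filterlim_tendsto_add_at_top[OF tendsto_const filterlim_real_sequentially])
    show "\<forall>\<^sub>F n in sequentially. - 1 + real n \<le> dist p (z n)"
      using zn by (simp add: algebra_simps)
  qed
  have "\<exists>c. \<forall>n. geodesic_segment (c n) p (z n)"
    using geo unfolding geodesic_space_def by (intro choice) auto
  then obtain c where c: "\<And>n. geodesic_segment (c n) p (z n)" by blast
  obtain g G where G: "G \<noteq> bot" "G \<le> sequentially" and g: "geodesic_ray g" "g 0 = p"
    and lim: "\<And>t. t \<ge> 0 \<Longrightarrow> ((\<lambda>n. c n t) \<longlongrightarrow> g t) G"
    using geodesic_segments_cluster[OF proper c inf] by blast
  have large: "\<forall>\<^sub>F n in G. T \<le> real n" for T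
    using filterlim_mono[OF filterlim_real_sequentially order_refl G(2)]
    by (simp add: filterlim_at_top)
  have "dist (\<sigma> t) (g t) \<le> 2 * \<delta>" if "t \<ge> 0" for t
  proof (rule tendsto_upperbound[OF _ _ G(1)])
    show "((\<lambda>n. dist (\<sigma> t) (c n t)) \<longlongrightarrow> dist (\<sigma> t) (g t)) G"
      using that by (intro tendsto_intros lim)
    \<comment> \<open>With \<open>x = \<sigma> (real n)\<close>, at distance \<open>n\<close> from
      \<open>p\<close>, the condition \<open>n \<ge> t + \<delta> + 1\<close> is the
      fellow-travelling threshold at \<open>u = t\<close>.\<close>
    show "\<forall>\<^sub>F n in G. dist (\<sigma> t) (c n t) \<le> 2 * \<delta>"
      using large[of "t + \<delta> + 1"]
    proof eventually_elim
      case (elim n)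
      have "geodesic_segment \<sigma> p (\<sigma> (real n))"
        using geodesic_ray_segment[OF \<sigma>(2), of "real n"] \<sigma>(3) by simp
      then show ?case
        using geodesic_segments_fellow_travel[OF geo thin _ c[of n], where u = t] z(2)[of n] elim
          that p\<sigma>[of "real n"] by simp
    qed
  qed
  then have "g \<in> \<eta>" using asymptotic_in_class[OF \<eta> \<sigma>(1) g(1)] by blast
  moreover have "t - dist (f (g t)) p \<le> L" if t: "t \<ge> 0" for t
  proof (rule tendsto_le[OF G(1)])
    have "((\<lambda>n. dist (f (c n t)) (f (g t))) \<longlongrightarrow> 0) G"
    proof (rule tendsto_sandwich[OF _ _ tendsto_const])
      show "((\<lambda>n. dist (c n t) (g t)) \<longlongrightarrow> 0) G"
        by (rule iffD1[OF tendsto_dist_iff lim[OF t]])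
    qed (use f in \<open>simp_all add: non_expanding_def\<close>)
    then have "((\<lambda>n. f (c n t)) \<longlongrightarrow> f (g t)) G" by (rule iffD2[OF tendsto_dist_iff])
    then show "((\<lambda>n. t - dist (f (c n t)) p) \<longlongrightarrow> t - dist (f (g t)) p) G"
      by (intro tendsto_intros)
    have "((\<lambda>n. L + inverse (real (Suc n))) \<longlongrightarrow> L + 0) sequentially"
      by (intro tendsto_intros LIMSEQ_inverse_real_of_nat)
    then show "((\<lambda>n. L + inverse (real (Suc n))) \<longlongrightarrow> L) G"
      using tendsto_mono[OF G(2)] by simp
    \<comment> \<open>For \<open>n \<ge> t + 1\<close> one has
      \<open>dist p (z n) \<ge> n - 1 \<ge> t\<close>, so \<open>c n t\<close> lies on the segment
      to \<open>z n\<close> and the bracket in \<open>non_expanding_displacement\<close> is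
      zero.\<close>
    show "\<forall>\<^sub>F n in G. t - dist (f (c n t)) p \<le> L + inverse (real (Suc n))"
      using large[of "t + 1"]
    proof eventually_elim
      case (elim n)
      then have "t \<le> dist p (z n)" using zn[of n] by linarith
      note d = geodesic_segment_dist[OF c t this]
      show ?case
        using non_expanding_displacement[OF f, of "c n t" p "z n"] d z(1)[of n]
        by (simp add: dist_commute)
    qed
  qed
  ultimately show thesis using that g by blast
qed

section \<open>Julia's inequality for horofunctions\<close>

theorem theorem6p28:
  fixes f :: "'a::metric_space \<Rightarrow> 'a"
    and p :: 'a
    and \<eta> \<xi> :: "(real \<Rightarrow> 'a) set"
    and \<Phi> :: "'a + (real \<Rightarrow> 'a) set \<Rightarrow> ('a \<Rightarrow> real) set"
  assumes "proper_space TYPE('a)"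
    and "geodesic_space TYPE('a)"
    and "gromov_hyperbolic TYPE('a)"
    and "compactification_equiv p \<Phi>"
    and "non_expanding f"
    and "\<eta> \<in> gromov_boundary"
    and "dilation f p \<eta> < \<infinity>"
    and "\<xi> \<in> gromov_boundary"
    and "has_geodesic_limit p f \<eta> (Inr \<xi>)"
  shows "\<forall>R>0. f ` horosphere p (\<Phi> (Inr \<eta>)) R
           \<subseteq> horosphere p (\<Phi> (Inr \<xi>)) (real_of_ereal (dilation f p \<eta>) * R)"
proof -
  obtain L where L: "dilation f p \<eta> = ereal (exp L)"
    "\<And>e. e > 0 \<Longrightarrow> \<exists>\<^sub>F z in filtercomap Inl (nhdsin (gromov_top p) (Inr \<eta>)).
        dist z p - dist (f z) p < L + e"
    using dilation_finite[OF assms(5,7)] by blast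
  obtain g where g: "g \<in> \<eta>" "geodesic_ray g" "g 0 = p"
    and gL: "\<And>t. t \<ge> 0 \<Longrightarrow> t - dist (f (g t)) p \<le> L"
    using ray_realizing_dilation[OF assms(1-6) L(2)] by blast
  have lim: "limitin (gromov_top p) (\<lambda>n. Inl (g (real n))) (Inr \<eta>) sequentially"
    by (rule limitin_gromov_ray[OF assms(6) g])
  have "g (real n) \<in> geodesic_region g 1" for n
    by (auto simp: geodesic_region_def)
  then have limf: "limitin (gromov_top p) (\<lambda>n. Inl (f (g (real n)))) (Inr \<xi>) sequentially"
    using assms(9) g(1) lim unfolding has_geodesic_limit_def by (metis zero_less_one)
  \<comment> \<open>The inequality holds before the limit: \<open>dist p (g (real n)) = n\<close>
    exceeds \<open>dist p (f (g (real n)))\<close> by at most \<open>L\<close>, and \<open>f\<close>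
    does not increase \<open>dist x (g (real n))\<close>.\<close>
  have julia: "horofunction (\<Phi> (Inr \<xi>)) p (f x) \<le> horofunction (\<Phi> (Inr \<eta>)) p x + L" for x
  proof (rule tendsto_le[OF sequentially_bot])
    show "(\<lambda>n. dist (f x) (f (g (real n))) - dist p (f (g (real n))))
        \<longlonglongrightarrow> horofunction (\<Phi> (Inr \<xi>)) p (f x)"
      by (rule tendsto_horofunction[OF assms(4) limf])
    show "(\<lambda>n. dist x (g (real n)) - dist p (g (real n)) + L)
        \<longlonglongrightarrow> horofunction (\<Phi> (Inr \<eta>)) p x + L"
      by (intro tendsto_add tendsto_const tendsto_horofunction[OF assms(4) lim])
    have "dist (f x) (f (g (real n))) - dist p (f (g (real n)))
        \<le> dist x (g (real n)) - dist p (g (real n)) + L" for n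
    proof -
      have "dist p (g (real n)) = real n"
        using g(2,3) by (auto simp: geodesic_ray_def)
      moreover have "dist (f x) (f (g (real n))) \<le> dist x (g (real n))"
        using assms(5) by (simp add: non_expanding_def)
      ultimately show ?thesis
        using gL[of "real n"] by (simp add: dist_commute)
    qed
    then show "\<forall>\<^sub>F n in sequentially. dist (f x) (f (g (real n))) - dist p (f (g (real n)))
        \<le> dist x (g (real n)) - dist p (g (real n)) + L" by simp
  qed
  show ?thesis
  proof (intro allI impI subsetI)
    fix R :: real and y
    assume R: "R > 0" and "y \<in> f ` horosphere p (\<Phi> (Inr \<eta>)) R"
    then obtain x where x: "y = f x" "horofunction (\<Phi> (Inr \<eta>)) p x < ln R"
      by (auto simp: horosphere_def)
    \<comment> \<open>The factor \<open>exp L\<close> in the radius becomes the additive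
      \<open>L\<close> of \<open>julia\<close>.\<close>
    have "ln (exp L * R) = L + ln R" using R by (simp add: ln_mult)
    then show "y \<in> horosphere p (\<Phi> (Inr \<xi>)) (real_of_ereal (dilation f p \<eta>) * R)"
      using julia[of x] x by (simp add: horosphere_def L(1))
  qed
qed

end
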